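(* Let $P\subset\mathbb{R}^3$ be a perfectly centered $3$-dimensional polytope. Define $P^{(0)}=P$ and $P^{(i)}=P^{(i-1)}+\bigl(P^{(i-1)}\bigr)^*$ for $i\ge 1$, and let $f_k^{(i)}$ be the number of $k$-dimensional faces of $P^{(i)}$. Then for every $n\ge 1$: $$f_0^{(n)} = 4^{n-1} f_0^{(1)},\qquad f_1^{(n)} = 2\cdot4^{n-1} f_0^{(1)},\qquad f_2^{(n)} = f_2^{(1)}+(4^{n-1}-1) f_0^{(1)}.$$
   Context: $+$ denotes Minkowski sum, and the dual of a polytope $Q\subset\mathbb{R}^d$ containing the origin in its interior is $Q^*=\{x:\langle x,y\rangle\le1\ \forall y\in Q\}$. For a nonempty face $F$ of $Q$, the outer normal cone $\mathcal{N}(F;Q)$ is the set of $c\in\mathbb{R}^d$ such that $F$ is exactly the set of maximizers of $\langle\cdot,c\rangle$ over $Q$. A full-dimensional polytope $Q\subset\mathbb{R}^d$ is perfectly centered if $\mathrm{relint}(F)\cap\mathcal{N}(F;Q)\neq\emptyset$ for every nonempty face $F$ of $Q$ (including $F=Q$, where $\mathcal{N}(Q;Q)=\{0\}$, so the origin is in the interior of $Q$). It is known that $Q+Q^*$ is perfectly centered whenever $Q$ is, so in particular all duals in the recursion are well defined polytopes. *)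

theory Defs
  imports "HOL-Analysis.Analysis"
begin

text \<open>Minkowski sums are written with the pointwise \<open>+\<close> on sets from
  \<open>HOL-Library.Set_Algebras\<close>.\<close>

text \<open>The dual is a total function on sets. It is a polytope only for a polytope with the
  origin in its interior, which holds for every perfectly centered polytope.\<close>

definition dual_polytope :: "'a::euclidean_space set \<Rightarrow> 'a set" where
  "dual_polytope Q = {x. \<forall>y\<in>Q. x \<bullet> y \<le> 1}"

definition outer_normal_cone :: "'a::euclidean_space set \<Rightarrow> 'a set \<Rightarrow> 'a set" where
  "outer_normal_cone F Q = {c. F = {x \<in> Q. \<forall>y\<in>Q. y \<bullet> c \<le> x \<bullet> c}}"

text \<open>The face \<open>F = Q\<close> is included, since a convex set is a face of itself in the sense of
  \<open>face_of\<close>; that instance forces the origin into the interior of \<open>Q\<close>.\<close>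

definition perfectly_centered :: "'a::euclidean_space set \<Rightarrow> bool" where
  "perfectly_centered Q \<longleftrightarrow>
     polytope Q \<and> aff_dim Q = int DIM('a) \<and>
     (\<forall>F. F face_of Q \<and> F \<noteq> {} \<longrightarrow> rel_interior F \<inter> outer_normal_cone F Q \<noteq> {})"

primrec dual_sum_iterate :: "'a::euclidean_space set \<Rightarrow> nat \<Rightarrow> 'a set" where
  "dual_sum_iterate P 0 = P"
| "dual_sum_iterate P (Suc i) = dual_sum_iterate P i + dual_polytope (dual_sum_iterate P i)"

text \<open>The empty face has \<open>aff_dim\<close> equal to \<open>-1\<close>, so it is never counted.\<close>

definition num_faces :: "nat \<Rightarrow> 'a::euclidean_space set \<Rightarrow> nat" where
  "num_faces k Q = card {F. F face_of Q \<and> aff_dim F = int k}"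

end

theory Submission
  imports Defs
begin

text \<open>For a perfectly centered polytope \<open>P\<close> of dimension \<open>d\<close>, the proper faces of \<open>P + P\<^sup>*\<close> are exactly
  the sums \<open>F + G'\<close>, where \<open>F \<subseteq> G\<close> are proper faces of \<open>P\<close> and \<open>G'\<close> is the face of \<open>P\<^sup>*\<close> dual to
  \<open>G\<close>. Indeed, the face of \<open>P + P\<^sup>*\<close> in direction \<open>c\<close> is such a sum, where \<open>F\<close> is the face of \<open>P\<close> in
  direction \<open>c\<close> and \<open>G\<close> is the face of \<open>P\<close> whose relative interior meets the ray through \<open>c\<close>;
  being perfectly centered forces \<open>F \<subseteq> G\<close>. As \<open>F\<close> and \<open>G'\<close> are orthogonal, the sum has dimension
  \<open>dim F + d - 1 - dim G\<close>. For \<open>d = 3\<close>, counting pairs \<open>F \<subseteq> G\<close> by the dimension of the sum gives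
  \<open>f\<^sub>0(P + P\<^sup>*) = 2 f\<^sub>1(P)\<close>, \<open>f\<^sub>1(P + P\<^sup>*) = 4 f\<^sub>1(P)\<close> and \<open>f\<^sub>2(P + P\<^sup>*) = f\<^sub>0(P) + f\<^sub>1(P) + f\<^sub>2(P)\<close>,
  because exactly two faces lie strictly between faces whose dimensions differ by two.\<close>

section \<open>Faces as sets of maximizers of linear functionals\<close>

definition max_face :: "'a::euclidean_space set \<Rightarrow> 'a \<Rightarrow> 'a set" where
  "max_face Q c = {x \<in> Q. \<forall>y\<in>Q. y \<bullet> c \<le> x \<bullet> c}"

lemma outer_normal_cone_iff: "c \<in> outer_normal_cone F Q \<longleftrightarrow> F = max_face Q c"
  by (simp add: outer_normal_cone_def max_face_def)

lemma max_face_eq_hyperplane: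
  assumes "x \<in> max_face Q c"
  shows "max_face Q c = Q \<inter> {y. c \<bullet> y = c \<bullet> x}"
proof -
  have x: "x \<in> Q" "\<And>y. y \<in> Q \<Longrightarrow> c \<bullet> y \<le> c \<bullet> x"
    using assms by (auto simp: max_face_def inner_commute[of c])
  have "max_face Q c = {y \<in> Q. \<forall>z\<in>Q. c \<bullet> z \<le> c \<bullet> y}"
    by (simp add: max_face_def inner_commute[of c])
  also have "\<dots> = Q \<inter> {y. c \<bullet> y = c \<bullet> x}"
    using x by (auto intro: antisym)
  finally show ?thesis .
qed

lemma max_face_face_of:
  assumes "convex Q"
  shows "max_face Q c face_of Q"
proof (cases "max_face Q c = {}")
  case False
  then obtain x where x: "x \<in> max_face Q c" by blast
  then have "c \<bullet> y \<le> c \<bullet> x" if "y \<in> Q" for y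
    using that by (simp add: max_face_def inner_commute[of c])
  then show ?thesis
    unfolding max_face_eq_hyperplane[OF x]
    using assms face_of_Int_supporting_hyperplane_le by blast
qed simp

lemma max_face_nonempty:
  assumes "compact Q" "Q \<noteq> {}"
  shows "max_face Q c \<noteq> {}"
proof -
  have "continuous_on Q (\<lambda>x. x \<bullet> c)" by (intro continuous_intros)
  then show ?thesis
    using continuous_attains_sup[OF assms] by (fastforce simp: max_face_def)
qed

lemma max_face_set_plus: "max_face (A + B) c = max_face A c + max_face B c"
proof
  show "max_face (A + B) c \<subseteq> max_face A c + max_face B c"
  proof
    fix x assume "x \<in> max_face (A + B) c"
    then obtain a b where ab: "a \<in> A" "b \<in> B" "x = a + b"
      and max: "\<And>a' b'. a' \<in> A \<Longrightarrow> b' \<in> B \<Longrightarrow> (a' + b') \<bullet> c \<le> (a + b) \<bullet> c"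
      by (auto simp: max_face_def elim!: set_plus_elim)
    have "a \<in> max_face A c" using ab max[of _ b] by (auto simp: max_face_def inner_add_left)
    moreover have "b \<in> max_face B c"
      using ab max[of a] by (auto simp: max_face_def inner_add_left)
    ultimately show "x \<in> max_face A c + max_face B c" using ab by auto
  qed
next
  show "max_face A c + max_face B c \<subseteq> max_face (A + B) c"
    by (auto simp: max_face_def inner_add_left intro!: add_mono elim!: set_plus_elim)
qed

text \<open>Stronger than \<open>max_face_set_plus\<close>: it speaks about one given decomposition
  of a point, so both summands of a face can later be read off from the sum.\<close>

lemma mem_max_face_set_plus_iff:
  assumes "a \<in> A" "b \<in> B"
  shows "a + b \<in> max_face (A + B) c \<longleftrightarrow> a \<in> max_face A c \<and> b \<in> max_face B c"
proof
  assume "a + b \<in> max_face (A + B) c"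
  then have max: "(a' + b') \<bullet> c \<le> (a + b) \<bullet> c" if "a' \<in> A" "b' \<in> B" for a' b'
    using that by (auto simp: max_face_def)
  show "a \<in> max_face A c \<and> b \<in> max_face B c"
    using assms max[of _ b] max[of a] by (auto simp: max_face_def inner_add_left)
qed (auto simp: max_face_set_plus)

lemma max_face_scaleR:
  assumes "t > 0"
  shows "max_face Q (t *\<^sub>R c) = max_face Q c"
  using assms by (simp add: max_face_def)

text \<open>At a common maximizer both functionals reach their bounds at once, so their sum is
  maximal exactly where each of them is.\<close>

lemma max_face_add:
  assumes "max_face Q c \<inter> max_face Q d \<noteq> {}"
  shows "max_face Q (c + d) = max_face Q c \<inter> max_face Q d"
proof -
  obtain z where z: "z \<in> max_face Q c" "z \<in> max_face Q d" using assms by blast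
  have "x \<in> max_face Q c \<inter> max_face Q d" if x: "x \<in> max_face Q (c + d)" for x
  proof -
    have "x \<in> Q" "z \<bullet> (c + d) \<le> x \<bullet> (c + d)" "x \<bullet> c \<le> z \<bullet> c" "x \<bullet> d \<le> z \<bullet> d"
      using x z by (auto simp: max_face_def)
    then have "x \<bullet> c = z \<bullet> c" "x \<bullet> d = z \<bullet> d" by (auto simp: inner_add_right)
    then show ?thesis using z \<open>x \<in> Q\<close> by (simp add: max_face_def)
  qed
  moreover have "max_face Q c \<inter> max_face Q d \<subseteq> max_face Q (c + d)"
    by (auto simp: max_face_def inner_add_right intro: add_mono)
  ultimately show ?thesis by blast
qed

text \<open>Faces of a polyhedron are exposed. Since the face is nonempty, the bound of the exposing
  hyperplane is attained and is therefore the maximum.\<close>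

lemma face_eq_max_face:
  assumes "polyhedron Q" "F face_of Q" "F \<noteq> {}"
  obtains c where "F = max_face Q c"
proof -
  have "F exposed_face_of Q" using assms exposed_face_of_polyhedron by blast
  then obtain a b where ab: "Q \<subseteq> {x. a \<bullet> x \<le> b}" "F = Q \<inter> {x. a \<bullet> x = b}"
    by (auto simp: exposed_face_of_def)
  then obtain x where "x \<in> max_face Q a"
    using assms(3) by (fastforce simp: max_face_def inner_commute)
  moreover obtain y where "y \<in> F" using assms(3) by blast
  ultimately have "a \<bullet> y \<le> a \<bullet> x" "a \<bullet> y = b" "a \<bullet> x \<le> b"
    using ab by (auto simp: max_face_def inner_commute)
  then have "a \<bullet> x = b" by simp
  then have "F = max_face Q a"
    using ab(2) max_face_eq_hyperplane[OF \<open>x \<in> max_face Q a\<close>] by simp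
  then show thesis by (rule that)
qed

text \<open>A proper face misses the relative interior, so a functional that is maximal at a
  relative interior point is constant.\<close>

lemma max_face_rel_interior:
  assumes "convex G" "x \<in> rel_interior G" "x \<in> max_face G c"
  shows "max_face G c = G"
  using face_of_disjoint_rel_interior[OF max_face_face_of[OF assms(1)]] assms by blast

text \<open>Take an inclusion-minimal face containing \<open>x\<close>. If \<open>x\<close> were on
  its relative boundary, a facet of it would be a smaller such face.\<close>

lemma rel_interior_face_exists:
  fixes P :: "'a::euclidean_space set"
  assumes "polytope P" "x \<in> P"
  obtains G where "G face_of P" "x \<in> rel_interior G"
proof -
  let ?A = "{G. G face_of P \<and> x \<in> G}"
  have "finite ?A" using finite_polytope_faces[OF assms(1)] by (rule rev_finite_subset) auto
  moreover have "P \<in> ?A"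
    using assms by (simp add: face_of_refl polytope_imp_convex)
  ultimately obtain G where G: "G \<in> ?A" and min: "\<And>H. H \<in> ?A \<Longrightarrow> \<not> H \<subset> G"
    using finite_has_minimal[of ?A] by blast
  have "polyhedron G"
    using G assms(1) face_of_polytope_polytope polytope_imp_polyhedron by blast
  have "x \<in> rel_interior G"
  proof (rule ccontr)
    assume "x \<notin> rel_interior G"
    then have "x \<in> \<Union> {F. F facet_of G}"
      using G rel_boundary_of_polyhedron[OF \<open>polyhedron G\<close>] by blast
    then obtain F where F: "F facet_of G" "x \<in> F" by blast
    then have "F \<subset> G" using facet_of_imp_subset facet_of_irrefl by blast
    moreover have "F \<in> ?A"
      using F G facet_of_imp_face_of face_of_trans by blast
    ultimately show False using min by blast
  qed
  then show thesis using G that by blast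
qed

section \<open>Minkowski sums of polytopes and their dimension\<close>

lemma polytope_set_plus:
  assumes "polytope A" "polytope B"
  shows "polytope (A + B)"
  using assms unfolding polytope_def
  by (metis convex_hull_set_plus finite_set_plus)

text \<open>After translating both sets to contain the origin, their spans are orthogonal, hence
  meet only in 0, and the linear dimensions add.\<close>

lemma aff_dim_set_plus_orthogonal:
  fixes A B :: "'a::euclidean_space set"
  assumes "A \<noteq> {}" "B \<noteq> {}"
    and orth: "\<And>a a' b b'. \<lbrakk>a \<in> A; a' \<in> A; b \<in> B; b' \<in> B\<rbrakk> \<Longrightarrow> (a - a') \<bullet> (b - b') = 0"
  shows "aff_dim (A + B) = aff_dim A + aff_dim B"
proof -
  obtain a b where ab: "a \<in> A" "b \<in> B" using assms by blast
  define A' where "A' = (+) (- a) ` A"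
  define B' where "B' = (+) (- b) ` B"
  have AB: "(+) (- (a + b)) ` (A + B) = A' + B'"
  proof -
    have "(+) (- (a + b)) ` (A + B) = {-a} + {-b} + (A + B)"
      by (simp add: set_plus_image flip: image_Collect) (auto simp: set_plus_def)
    also have "\<dots> = ({-a} + A) + ({-b} + B)" by (simp add: ac_simps)
    also have "\<dots> = A' + B'" by (simp add: A'_def B'_def set_plus_def image_def)
    finally show ?thesis .
  qed
  have 0: "0 \<in> A'" "0 \<in> B'" using ab by (auto simp: A'_def B'_def)
  have "orthogonal x y" if "x \<in> A'" "y \<in> B'" for x y
    using that orth ab by (auto simp: A'_def B'_def orthogonal_def)
  then have orth': "orthogonal x y" if "x \<in> span A'" "y \<in> span B'" for x y
    using that orthogonal_to_span orthogonal_commute by metis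
  have "span (A' + B') = {x + y |x y. x \<in> span A' \<and> y \<in> span B'}"
  proof -
    have "A' \<union> B' \<subseteq> A' + B'"
      using 0 by (metis Un_least set_zero_plus2 add.commute)
    moreover have "A' + B' \<subseteq> span (A' \<union> B')"
      by (auto simp: set_plus_def intro: span_add[OF span_base span_base])
    ultimately have "span (A' + B') = span (A' \<union> B')"
      by (metis span_mono span_span subset_antisym)
    then show ?thesis by (simp add: span_Un)
  qed
  then have "dim (A' + B') = dim {x + y |x y. x \<in> span A' \<and> y \<in> span B'}"
    by (metis dim_span)
  moreover have "span A' \<inter> span B' = {0}"
    using orth' orthogonal_self by (blast intro: span_zero)
  ultimately have "dim (A' + B') = dim A' + dim B'"
    using dim_sums_Int[of "span A'" "span B'"] by simp
  moreover have "aff_dim (A + B) = int (dim (A' + B'))"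
    using aff_dim_eq_dim[of "a + b" "A + B"] ab AB by (metis hull_inc set_plus_intro)
  ultimately show ?thesis
    using aff_dim_eq_dim[of a A] aff_dim_eq_dim[of b B] ab by (simp add: A'_def B'_def hull_inc)
qed

section \<open>The dual polytope\<close>

lemma dual_polytope_convex_hull: "dual_polytope (convex hull V) = {x. \<forall>v\<in>V. x \<bullet> v \<le> 1}"
proof
  show "dual_polytope (convex hull V) \<subseteq> {x. \<forall>v\<in>V. x \<bullet> v \<le> 1}"
    by (auto simp: dual_polytope_def hull_inc)
  show "{x. \<forall>v\<in>V. x \<bullet> v \<le> 1} \<subseteq> dual_polytope (convex hull V)"
  proof
    fix x assume "x \<in> {x. \<forall>v\<in>V. x \<bullet> v \<le> 1}"
    then have "convex hull V \<subseteq> {y. x \<bullet> y \<le> 1}"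
      by (intro hull_minimal convex_halfspace_le) auto
    then show "x \<in> dual_polytope (convex hull V)" by (auto simp: dual_polytope_def)
  qed
qed

text \<open>The generators of \<open>P\<close> give finitely many halfspaces. For boundedness, pair
  \<open>x\<close> with the point of norm \<open>e\<close> in its own direction, which lies in
  \<open>P\<close>.\<close>

lemma polytope_dual_polytope:
  assumes "polytope P" "0 \<in> interior P"
  shows "polytope (dual_polytope P)"
proof -
  obtain V where V: "finite V" "P = convex hull V" using assms(1) by (auto simp: polytope_def)
  have "dual_polytope P = \<Inter> ((\<lambda>v. {x. v \<bullet> x \<le> 1}) ` V)"
    by (auto simp: V dual_polytope_convex_hull inner_commute)
  then have "polyhedron (dual_polytope P)"
    using V(1) by (auto intro!: polyhedron_Inter polyhedron_halfspace_le)
  moreover obtain e where e: "e > 0" "cball 0 e \<subseteq> P"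
    using assms(2) by (auto simp: mem_interior_cball)
  have "norm x \<le> 1 / e" if "x \<in> dual_polytope P" for x
  proof (cases "x = 0")
    case False
    have "(e / norm x) *\<^sub>R x \<in> P"
      using e False by (intro subsetD[OF e(2)]) auto
    then have "x \<bullet> ((e / norm x) *\<^sub>R x) \<le> 1"
      using that by (auto simp: dual_polytope_def)
    also have "x \<bullet> ((e / norm x) *\<^sub>R x) = e * norm x"
      using False by (simp add: dot_square_norm power2_eq_square)
    finally show ?thesis using e by (simp add: field_simps)
  qed (use e in auto)
  then have "bounded (dual_polytope P)" by (auto simp: bounded_iff)
  ultimately show ?thesis by (simp add: polytope_eq_bounded_polyhedron)
qed

section \<open>Perfectly centered polytopes and centers of faces\<close>

lemma perfectly_centered_imp_polytope: "perfectly_centered P \<Longrightarrow> polytope P"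
  by (simp add: perfectly_centered_def)

lemma perfectly_centered_face_center:
  assumes "perfectly_centered P" "F face_of P" "F \<noteq> {}"
  obtains x where "x \<in> rel_interior F" "F = max_face P x"
  using assms by (force simp: perfectly_centered_def outer_normal_cone_iff)

text \<open>The center \<open>x\<close> of the face \<open>P\<close> itself is an interior point
  maximizing its own functional. If it were nonzero, a small step along \<open>x\<close> would stay
  in \<open>P\<close> and increase the value.\<close>

lemma perfectly_centered_zero_interior:
  fixes P :: "'a::euclidean_space set"
  assumes "perfectly_centered P"
  shows "0 \<in> interior P"
proof -
  have P: "polytope P" "aff_dim P = int DIM('a)"
    using assms by (auto simp: perfectly_centered_def)
  then have "P \<noteq> {}" by auto
  then obtain x where x: "x \<in> rel_interior P" "P = max_face P x"
    using perfectly_centered_face_center[OF assms] P(1)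
    by (metis face_of_refl polytope_imp_convex)
  have int: "x \<in> interior P"
    using x(1) P(2) by (simp add: aff_dim_eq_full rel_interior_interior)
  then obtain e where e: "e > 0" "cball x e \<subseteq> P" by (auto simp: mem_interior_cball)
  have "x = 0"
  proof (rule ccontr)
    assume "x \<noteq> 0"
    have "x + (e / norm x) *\<^sub>R x \<in> P"
      using e \<open>x \<noteq> 0\<close> by (intro subsetD[OF e(2)]) (auto simp: dist_norm)
    moreover have "x \<in> max_face P x" using int x(2) interior_subset by blast
    ultimately have "(x + (e / norm x) *\<^sub>R x) \<bullet> x \<le> x \<bullet> x"
      by (auto simp: max_face_def)
    then have "(e / norm x) * (x \<bullet> x) \<le> 0" by (simp add: inner_add_left)
    moreover have "(e / norm x) * (x \<bullet> x) > 0" using e(1) \<open>x \<noteq> 0\<close> by simp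
    ultimately show False by simp
  qed
  then show ?thesis using int by simp
qed

section \<open>Dual faces, and maximizers over a perfectly centered polytope\<close>

text \<open>For a face \<open>G\<close> of \<open>P\<close>, this is the conjugate face under the
  classical polarity of face lattices.\<close>

definition dual_face :: "'a::euclidean_space set \<Rightarrow> 'a set \<Rightarrow> 'a set" where
  "dual_face G P = {q \<in> dual_polytope P. \<forall>g\<in>G. q \<bullet> g = 1}"

lemma max_face_zero: "max_face Q 0 = Q"
  by (simp add: max_face_def)

text \<open>The hyperplane through \<open>x\<close> with normal \<open>x\<close> supports
  \<open>P\<close>; rescaling the normal so that the bound becomes 1 gives a point of the dual. As
  \<open>max_face P x\<close> is not all of \<open>P\<close>, \<open>x\<close> is nonzero.\<close>

lemma scaled_normal_mem_dual:
  assumes "x \<in> max_face P x" "max_face P x \<noteq> P"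
  shows "x \<bullet> x > 0" "x /\<^sub>R (x \<bullet> x) \<in> dual_polytope P"
    and "p \<in> P \<Longrightarrow> (x /\<^sub>R (x \<bullet> x)) \<bullet> p = 1 \<longleftrightarrow> p \<in> max_face P x"
proof -
  have "x \<noteq> 0" using assms(2) max_face_zero by metis
  then show pos: "x \<bullet> x > 0" by simp
  have le: "p \<bullet> x \<le> x \<bullet> x" if "p \<in> P" for p
    using assms(1) that by (auto simp: max_face_def)
  then show "x /\<^sub>R (x \<bullet> x) \<in> dual_polytope P"
    using pos by (simp add: dual_polytope_def inner_commute field_simps)
  show "(x /\<^sub>R (x \<bullet> x)) \<bullet> p = 1 \<longleftrightarrow> p \<in> max_face P x" if "p \<in> P"
    using pos that by (auto simp: max_face_eq_hyperplane[OF assms(1)] field_simps)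
qed

text \<open>Near \<open>q\<close> the constraints from generators outside \<open>G\<close> are
  strict, so only the equations from \<open>G\<close> matter: \<open>?U \<inter> W\<close> is a
  relatively open part of the affine set \<open>?U\<close>, contains \<open>q\<close> and lies in
  the dual face.\<close>

lemma dual_face_hulls:
  assumes "polytope P" "q \<in> dual_polytope P" "\<And>p. p \<in> P \<Longrightarrow> q \<bullet> p = 1 \<longleftrightarrow> p \<in> G"
    and "G \<subseteq> P"
  shows rel_interior_dual_face: "q \<in> rel_interior (dual_face G P)"
    and affine_hull_dual_face: "affine hull (dual_face G P) = {x. \<forall>g\<in>G. x \<bullet> g = 1}"
proof -
  let ?U = "{x. \<forall>g\<in>G. x \<bullet> g = 1}"
  obtain V where V: "finite V" "P = convex hull V" using assms(1) by (auto simp: polytope_def)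
  define W where "W = (\<Inter>v\<in>V - G. {x. v \<bullet> x < 1})"
  have "open W" unfolding W_def using V(1) by (intro open_INT) (auto simp: open_halfspace_lt)
  have "affine ?U"
    by (auto simp: affine_def inner_add_left)
  have "V \<subseteq> P" by (simp add: V hull_subset)
  have "q \<bullet> v < 1" if "v \<in> V - G" for v
    using assms(2) assms(3)[of v] that \<open>V \<subseteq> P\<close> by (force simp: dual_polytope_def order.strict_iff_order)
  then have "q \<in> W" by (auto simp: W_def inner_commute)
  have qU: "q \<in> ?U" using assms(3,4) by blast
  have sub: "?U \<inter> W \<subseteq> dual_face G P"
  proof
    fix x assume x: "x \<in> ?U \<inter> W"
    have "x \<bullet> v \<le> 1" if "v \<in> V" for v
      using x that by (cases "v \<in> G") (auto simp: W_def inner_commute[of x] intro: less_imp_le)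
    then show "x \<in> dual_face G P"
      using x by (simp add: dual_face_def V dual_polytope_convex_hull)
  qed
  have sub': "dual_face G P \<subseteq> ?U" by (auto simp: dual_face_def)
  have "affine hull (?U \<inter> W) = ?U"
    using affine_hull_affine_Int_open[OF \<open>affine ?U\<close> \<open>open W\<close>] \<open>q \<in> W\<close> qU \<open>affine ?U\<close>
    by (metis (lifting) IntI affine_hull_eq empty_iff)
  then show hull: "affine hull (dual_face G P) = ?U"
    using hull_mono[OF sub] hull_minimal[where S = affine, OF sub' \<open>affine ?U\<close>] by blast
  have "?U \<inter> W \<subseteq> rel_interior (dual_face G P)"
    using sub \<open>open W\<close> by (intro rel_interior_maximal) (auto simp: hull openin_open)
  then show "q \<in> rel_interior (dual_face G P)" using \<open>q \<in> W\<close> qU by blast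
qed

lemma aff_dim_dual_affine:
  fixes G :: "'a::euclidean_space set"
  assumes "q \<in> {x. \<forall>g\<in>G. x \<bullet> g = 1}"
  shows "aff_dim {x. \<forall>g\<in>G. x \<bullet> g = 1} = int DIM('a) - 1 - aff_dim G"
proof -
  let ?U = "{x. \<forall>g\<in>G. x \<bullet> g = 1}"
  let ?W = "{y \<in> UNIV. \<forall>x\<in>span G. orthogonal x y}"
  have W: "y \<in> ?W \<longleftrightarrow> (\<forall>g\<in>G. y \<bullet> g = 0)" for y
  proof -
    have "y \<in> ?W" if "\<forall>g\<in>G. y \<bullet> g = 0"
      using that orthogonal_to_span[of _ G y] by (auto simp: orthogonal_def inner_commute)
    then show ?thesis by (auto simp: orthogonal_def inner_commute span_base)
  qed
  have "?U = (+) q ` ?W"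
  proof safe
    fix x assume x: "\<forall>g\<in>G. x \<bullet> g = 1"
    then have "x - q \<in> ?W" using assms unfolding W by (simp add: inner_diff_left)
    then show "x \<in> (+) q ` ?W" by force
  next
    fix y g assume "\<forall>x\<in>span G. orthogonal x y" "g \<in> G"
    then show "(q + y) \<bullet> g = 1" using assms W[of y] by (auto simp: inner_add_left)
  qed
  then have "aff_dim ?U = aff_dim ?W" by (simp add: aff_dim_translation_eq)
  also have "\<dots> = int (dim ?W)"
    by (rule aff_dim_zero) (auto intro!: hull_inc simp: orthogonal_def)
  also have "dim ?W + dim (span G) = dim (UNIV :: 'a set)"
    by (rule dim_subspace_orthogonal_to_vectors) auto
  then have "int (dim ?W) = int DIM('a) - int (dim G)" by simp
  \<comment> \<open>The hyperplane with normal \<open>q\<close> and value 1 contains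
    \<open>G\<close> but not the origin, so adjoining 0 raises the affine dimension by one.\<close>
  also have "int (dim G) = aff_dim G + 1"
  proof -
    have "affine hull G \<subseteq> {x. q \<bullet> x = 1}"
      using assms by (intro hull_minimal affine_hyperplane) auto
    then have "0 \<notin> affine hull G" by auto
    then have "aff_dim G + 1 = aff_dim (insert 0 G)" by (simp add: aff_dim_insert)
    also have "\<dots> = int (dim (insert 0 G))" by (intro aff_dim_zero hull_inc) simp
    finally show ?thesis by (metis dim_span span_insert_0)
  qed
  finally show ?thesis by simp
qed

text \<open>On the dual, \<open>y\<close> takes values at most 1. A point \<open>p\<close> reaching
  1 is, as a functional on \<open>G\<close>, maximal at the relative interior point
  \<open>y\<close>, hence equal to 1 on all of \<open>G\<close>.\<close>

lemma max_face_dual_polytope: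
  assumes "convex G" "y \<in> rel_interior G" "G \<subseteq> P" "dual_face G P \<noteq> {}"
  shows "max_face (dual_polytope P) y = dual_face G P"
proof -
  obtain q where q: "q \<in> dual_face G P" using assms(4) by blast
  have y: "y \<in> G" using assms(2) rel_interior_subset by blast
  have le: "p \<bullet> y \<le> 1" if "p \<in> dual_polytope P" for p
    using that y assms(3) by (auto simp: dual_polytope_def)
  have "q \<in> max_face (dual_polytope P) y"
    using q y le by (auto simp: dual_face_def max_face_def)
  then have "max_face (dual_polytope P) y = dual_polytope P \<inter> {p. y \<bullet> p = 1}"
    unfolding max_face_eq_hyperplane[OF \<open>q \<in> max_face (dual_polytope P) y\<close>]
    using q y by (simp add: dual_face_def inner_commute[of y])
  also have "\<dots> = dual_face G P"
  proof -
    have "p \<bullet> g = 1" if p: "p \<in> dual_polytope P" "p \<bullet> y = 1" and g: "g \<in> G" for p g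
    proof -
      have "y \<in> max_face G p"
        using y p assms(3) by (auto simp: max_face_def dual_polytope_def inner_commute)
      then have "g \<in> max_face G p" using max_face_rel_interior[OF assms(1,2)] g by blast
      then have "p \<bullet> y \<le> p \<bullet> g" using y by (simp add: max_face_def inner_commute[of p])
      then show ?thesis using p g assms(3) by (force simp: dual_polytope_def)
    qed
    then show ?thesis using y by (auto simp: dual_face_def inner_commute)
  qed
  finally show ?thesis .
qed

text \<open>Induction on \<open>dim G\<close>: \<open>x\<close> lies between the center of \<open>G\<close>, whose maximizers are all of \<open>G\<close>, and a
  point of a facet of \<open>G\<close>, whose maximizers lie in that facet; so those of \<open>x\<close> are common to both.\<close>

lemma max_face_subset_face:
  fixes P :: "'a::euclidean_space set"
  assumes "perfectly_centered P" "G face_of P" "x \<in> G"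
  shows "max_face P x \<subseteq> G"
  using assms(2,3)
proof (induction "nat (aff_dim G)" arbitrary: G x rule: less_induct)
  case less
  have P: "polytope P" using assms(1) by (rule perfectly_centered_imp_polytope)
  then have G: "polytope G" using less.prems face_of_polytope_polytope by blast
  obtain c where c: "c \<in> rel_interior G" "G = max_face P c"
    using perfectly_centered_face_center[OF assms(1) less.prems(1)] less.prems(2) by blast
  show ?case
  proof (cases "x = c")
    case False
    have "c + (x - c) \<in> affine hull G" using less.prems by (simp add: hull_inc)
    then obtain d where d: "d > 0" "c + d *\<^sub>R (x - c) \<in> rel_frontier G"
      using ray_to_rel_frontier[OF polytope_imp_bounded[OF G] c(1), of "x - c"] False by auto
    \<comment> \<open>The ray from the center \<open>c\<close> through \<open>x\<close> leaves
      \<open>G\<close> at \<open>z\<close>.\<close>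
    define z where "z = c + d *\<^sub>R (x - c)"
    \<comment> \<open>Otherwise \<open>z\<close> would lie strictly between \<open>c\<close> and
      \<open>x\<close>, hence in the relative interior of \<open>G\<close>.\<close>
    have "1 \<le> d"
    proof (rule ccontr)
      assume "\<not> 1 \<le> d"
      then have "x - (1 - d) *\<^sub>R (x - c) \<in> rel_interior G"
        using G c(1) less.prems d(1)
        by (intro rel_interior_convex_shrink) (auto simp: polytope_imp_convex)
      then show False using d(2) by (simp add: rel_frontier_def algebra_simps)
    qed
    obtain K where K: "K facet_of G" "z \<in> K"
      using d(2) rel_frontier_of_polyhedron[OF polytope_imp_polyhedron[OF G]] by (auto simp: z_def)
    have "nat (aff_dim K) < nat (aff_dim G)"
      using K(1) aff_dim_negative_iff[of K] by (auto simp: facet_of_def)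
    then have "max_face P z \<subseteq> K"
      using less.hyps K less.prems(1) facet_of_imp_face_of face_of_trans by blast
    then have zG: "max_face P z \<subseteq> G" using K(1) facet_of_imp_subset by blast
    show ?thesis
    proof (cases "d = 1")
      case True
      then show ?thesis using zG by (simp add: z_def)
    next
      case False
      then have "d > 1" using \<open>1 \<le> d\<close> by simp
      have "d *\<^sub>R x = (d - 1) *\<^sub>R c + z" by (simp add: z_def algebra_simps)
      then have "max_face P x = max_face P ((d - 1) *\<^sub>R c + z)"
        using d(1) max_face_scaleR by metis
      also have "\<dots> = max_face P ((d - 1) *\<^sub>R c) \<inter> max_face P z"
      proof (rule max_face_add)
        have "max_face P z \<noteq> {}"
          using P c less.prems face_of_imp_subset polytope_imp_compact
          by (intro max_face_nonempty) auto
        then show "max_face P ((d - 1) *\<^sub>R c) \<inter> max_face P z \<noteq> {}"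
          using zG c(2) \<open>d > 1\<close> by (auto simp: max_face_scaleR)
      qed
      finally show ?thesis using zG by blast
    qed
  qed (use c in blast)
qed

section \<open>Faces of the sum as pairs of nested proper faces\<close>

definition proper_faces :: "'a::euclidean_space set \<Rightarrow> 'a set set" where
  "proper_faces P = {F. F face_of P \<and> F \<noteq> {} \<and> F \<noteq> P}"

text \<open>The center of \<open>G\<close>, divided by its squared norm, serves as a relative
  interior point of the dual face; it touches \<open>P\<close> exactly in \<open>G\<close>.\<close>

lemma proper_face_dual:
  fixes P :: "'a::euclidean_space set"
  assumes P: "perfectly_centered P" and "G \<in> proper_faces P"
  obtains x t where "x \<in> rel_interior G" "G = max_face P x" "t > 0"
    "t *\<^sub>R x \<in> rel_interior (dual_face G P)"
    "\<And>p. p \<in> P \<Longrightarrow> (t *\<^sub>R x) \<bullet> p = 1 \<longleftrightarrow> p \<in> G"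
    "aff_dim (dual_face G P) = int DIM('a) - 1 - aff_dim G"
proof -
  have G: "G face_of P" "G \<noteq> {}" "G \<noteq> P" using assms(2) by (auto simp: proper_faces_def)
  obtain x where x: "x \<in> rel_interior G" "G = max_face P x"
    using perfectly_centered_face_center[OF P G(1,2)] by blast
  have "x \<in> max_face P x" using x rel_interior_subset by blast
  note q = scaled_normal_mem_dual[OF this]
  have *: "x \<bullet> x > 0" "x /\<^sub>R (x \<bullet> x) \<in> dual_polytope P"
    "\<And>p. p \<in> P \<Longrightarrow> (x /\<^sub>R (x \<bullet> x)) \<bullet> p = 1 \<longleftrightarrow> p \<in> G"
    using q G(3) x(2) by auto
  have GP: "G \<subseteq> P" using G(1) by (rule face_of_imp_subset)
  note ri = dual_face_hulls[OF perfectly_centered_imp_polytope[OF P] *(2,3) GP]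
  have "x /\<^sub>R (x \<bullet> x) \<in> {x. \<forall>g\<in>G. x \<bullet> g = 1}" using *(3) GP by blast
  from aff_dim_dual_affine[OF this]
  have "aff_dim (dual_face G P) = int DIM('a) - 1 - aff_dim G"
    using ri(2) aff_dim_affine_hull by metis
  then show thesis using that[of x "inverse (x \<bullet> x)"] x * ri(1) by simp
qed

text \<open>The center of \<open>F + dual_face G P\<close> is the center of \<open>F\<close> plus the multiple of the center of \<open>G\<close>
  that lies in the dual face.\<close>

lemma chain_face_center:
  assumes P: "perfectly_centered P" and "F \<in> proper_faces P" "G \<in> proper_faces P" "F \<subseteq> G"
  obtains c where "c \<in> rel_interior (F + dual_face G P)"
    "max_face P c = F" "max_face (dual_polytope P) c = dual_face G P"
proof -
  obtain x where x: "x \<in> rel_interior F" "F = max_face P x"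
    using perfectly_centered_face_center[OF P] assms(2) by (auto simp: proper_faces_def)
  obtain y t where y: "y \<in> rel_interior G" "G = max_face P y" and t: "t > 0"
    and ty: "t *\<^sub>R y \<in> rel_interior (dual_face G P)"
    using proper_face_dual[OF P assms(3)] by metis
  define c where "c = x + t *\<^sub>R y"
  have conv: "convex F" "convex G" "G \<subseteq> P"
    using assms(2,3) by (auto simp: proper_faces_def dest: face_of_imp_convex face_of_imp_subset)
  have "convex (dual_face G P)"
  proof -
    have "dual_face G P = (\<Inter>p\<in>P. {x. p \<bullet> x \<le> 1}) \<inter> (\<Inter>g\<in>G. {x. g \<bullet> x = 1})"
      by (auto simp: dual_face_def dual_polytope_def inner_commute)
    then show ?thesis
      by (auto intro!: convex_Int convex_INT convex_halfspace_le convex_hyperplane)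
  qed
  then have "c \<in> rel_interior (F + dual_face G P)"
    using x ty conv by (auto simp: rel_interior_sum c_def)
  moreover have "max_face P c = F"
  proof -
    have "F \<inter> G \<noteq> {}" using assms(2,4) by (auto simp: proper_faces_def)
    then show ?thesis
      using max_face_add[of P x "t *\<^sub>R y"] x(2) y(2) t assms(4) by (auto simp: c_def max_face_scaleR)
  qed
  moreover have "max_face (dual_polytope P) c = dual_face G P"
  proof -
    \<comment> \<open>Chosen so that \<open>c\<close> is \<open>1 + t\<close> times a convex
      combination of \<open>x\<close> in \<open>G\<close> and \<open>y\<close> in the relative
      interior of \<open>G\<close>. That combination is again in the relative interior, and the
      scaling keeps the maximizers.\<close>
    define e where "e = t / (1 + t)"
    have e: "0 < e" "e \<le> 1" using t by (auto simp: e_def)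
    have "x \<in> G" using x(1) assms(4) rel_interior_subset by blast
    then have ri: "x - e *\<^sub>R (x - y) \<in> rel_interior G"
      using e y(1) conv(2) by (intro rel_interior_convex_shrink) auto
    have "x - e *\<^sub>R (x - y) = (1 - e) *\<^sub>R x + e *\<^sub>R y" by (simp add: algebra_simps)
    moreover have "(1 + t) * (1 - e) = 1" "(1 + t) * e = t" using t by (auto simp: e_def field_simps)
    ultimately have "c = (1 + t) *\<^sub>R (x - e *\<^sub>R (x - y))"
      by (simp add: c_def scaleR_add_right)
    moreover have "dual_face G P \<noteq> {}" using ty rel_interior_subset by blast
    ultimately show ?thesis
      using max_face_dual_polytope[OF conv(2) ri conv(3)] t by (simp add: max_face_scaleR)
  qed
  ultimately show thesis by (rule that)
qed

text \<open>The last two claims reconstruct \<open>F\<close> and \<open>G\<close> from the sum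
  alone, which makes the pairing with faces injective. \<open>F\<close> is the set of first
  summands; \<open>G\<close> is where all second summands take the value 1.\<close>

lemma chain_face_props:
  fixes P :: "'a::euclidean_space set"
  assumes P: "perfectly_centered P" and "F \<in> proper_faces P" "G \<in> proper_faces P" "F \<subseteq> G"
  shows chain_face_of: "F + dual_face G P face_of P + dual_polytope P"
    and aff_dim_chain_face:
      "aff_dim (F + dual_face G P) = aff_dim F + int DIM('a) - 1 - aff_dim G"
    and chain_face_fst: "F = {p \<in> P. \<exists>q\<in>dual_polytope P. p + q \<in> F + dual_face G P}"
    and chain_face_snd:
      "G = {p \<in> P. \<forall>q\<in>dual_polytope P. (\<exists>r\<in>P. r + q \<in> F + dual_face G P) \<longrightarrow> q \<bullet> p = 1}"
proof -
  obtain c where c: "max_face P c = F" "max_face (dual_polytope P) c = dual_face G P"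
    using chain_face_center[OF assms] by metis
  then have H: "F + dual_face G P = max_face (P + dual_polytope P) c"
    by (simp add: max_face_set_plus)
  have pol: "polytope P" "polytope (dual_polytope P)"
    using P perfectly_centered_imp_polytope perfectly_centered_zero_interior polytope_dual_polytope
    by auto
  then show "F + dual_face G P face_of P + dual_polytope P"
    unfolding H by (intro max_face_face_of polytope_imp_convex polytope_set_plus)
  obtain x t where x: "t *\<^sub>R x \<in> rel_interior (dual_face G P)"
    "\<And>p. p \<in> P \<Longrightarrow> (t *\<^sub>R x) \<bullet> p = 1 \<longleftrightarrow> p \<in> G"
    and dim: "aff_dim (dual_face G P) = int DIM('a) - 1 - aff_dim G"
    using proper_face_dual[OF P assms(3)] by metis
  have q: "t *\<^sub>R x \<in> dual_face G P" using x(1) rel_interior_subset by blast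
  then have qd: "t *\<^sub>R x \<in> dual_polytope P" by (simp add: dual_face_def)
  have F: "F \<noteq> {}" "F \<subseteq> P" and G: "G \<subseteq> P"
    using assms(2,3) by (auto simp: proper_faces_def dest: face_of_imp_subset)
  have "(a - a') \<bullet> (b - b') = 0" if "a \<in> F" "a' \<in> F" "b \<in> dual_face G P" "b' \<in> dual_face G P"
    for a a' b b'
  proof -
    have "b \<bullet> a = 1" "b \<bullet> a' = 1" "b' \<bullet> a = 1" "b' \<bullet> a' = 1"
      using that assms(4) by (auto simp: dual_face_def)
    then show ?thesis
      by (simp add: inner_diff_left inner_diff_right inner_commute[of a] inner_commute[of a'])
  qed
  then have "aff_dim (F + dual_face G P) = aff_dim F + aff_dim (dual_face G P)"
    using F q by (intro aff_dim_set_plus_orthogonal) auto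
  then show "aff_dim (F + dual_face G P) = aff_dim F + int DIM('a) - 1 - aff_dim G"
    using dim by simp
  have mem: "p + q \<in> F + dual_face G P \<longleftrightarrow> p \<in> F \<and> q \<in> dual_face G P"
    if "p \<in> P" "q \<in> dual_polytope P" for p q
    unfolding H using that by (simp add: mem_max_face_set_plus_iff c)
  show "F = {p \<in> P. \<exists>q\<in>dual_polytope P. p + q \<in> F + dual_face G P}"
    using mem q qd F by blast
  show "G = {p \<in> P. \<forall>q\<in>dual_polytope P. (\<exists>r\<in>P. r + q \<in> F + dual_face G P) \<longrightarrow> q \<bullet> p = 1}"
    (is "G = ?R")
  proof
    have "q \<bullet> p = 1" if "p \<in> G" "q \<in> dual_face G P" for p q
      using that by (simp add: dual_face_def)
    then show "G \<subseteq> ?R" using mem G by blast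
    have "p \<in> G" if "p \<in> ?R" for p
    proof -
      obtain r where "r \<in> F" using F by blast
      then have "(t *\<^sub>R x) \<bullet> p = 1" using that mem[of r "t *\<^sub>R x"] q qd F by blast
      then show ?thesis using x(2) that by blast
    qed
    then show "?R \<subseteq> G" by blast
  qed
qed

lemma face_of_dual_sum_chain:
  fixes P :: "'a::euclidean_space set"
  assumes P: "perfectly_centered P"
    and "H face_of P + dual_polytope P" "H \<noteq> {}" "H \<noteq> P + dual_polytope P"
  obtains F G where "F \<in> proper_faces P" "G \<in> proper_faces P" "F \<subseteq> G" "H = F + dual_face G P"
proof -
  have int: "0 \<in> interior P" using P by (rule perfectly_centered_zero_interior)
  have pol: "polytope P" "polytope (dual_polytope P)"
    using P perfectly_centered_imp_polytope int polytope_dual_polytope by auto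
  obtain c where c: "H = max_face (P + dual_polytope P) c"
    using face_eq_max_face polytope_set_plus[OF pol] polytope_imp_polyhedron assms(2,3) by metis
  then have "c \<noteq> 0" using assms(4) max_face_zero by metis
  have hull: "affine hull P = UNIV"
    using P by (simp add: perfectly_centered_def flip: aff_dim_eq_full)
  have "0 \<in> rel_interior P" using int interior_subset_rel_interior by blast
  \<comment> \<open>Positive scaling keeps the maximizers of \<open>c\<close>, so the direction may
    be replaced by a boundary point of \<open>P\<close>.\<close>
  then obtain t where t: "t > 0" "t *\<^sub>R c \<in> rel_frontier P"
    using ray_to_rel_frontier[OF polytope_imp_bounded[OF pol(1)], of 0 c] \<open>c \<noteq> 0\<close> hull
    by (metis UNIV_I add_0)
  have tP: "t *\<^sub>R c \<in> P" "t *\<^sub>R c \<notin> rel_interior P"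
    using t(2) pol(1) by (auto simp: rel_frontier_def polytope_imp_closed)
  obtain G where G: "G face_of P" "t *\<^sub>R c \<in> rel_interior G"
    using rel_interior_face_exists[OF pol(1) tP(1)] by blast
  have tG: "t *\<^sub>R c \<in> G" using G(2) rel_interior_subset by blast
  have Gp: "G \<in> proper_faces P" using G tG tP(2) by (auto simp: proper_faces_def)
  define F where "F = max_face P c"
  have FG: "F \<subseteq> G"
    using max_face_subset_face[OF P G(1) tG] t(1) by (simp add: F_def max_face_scaleR)
  have "F face_of P" unfolding F_def using pol(1) by (intro max_face_face_of polytope_imp_convex)
  moreover have "F \<noteq> {}"
    unfolding F_def using pol(1) tP(1) by (intro max_face_nonempty polytope_imp_compact) auto
  moreover have "F \<noteq> P" using FG Gp face_of_imp_subset by (auto simp: proper_faces_def)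
  ultimately have "F \<in> proper_faces P" by (simp add: proper_faces_def)
  moreover have "dual_face G P \<noteq> {}"
    using proper_face_dual[OF P Gp] rel_interior_subset by (metis empty_iff subsetD)
  then have "max_face (dual_polytope P) c = dual_face G P"
    using max_face_dual_polytope[of G "t *\<^sub>R c" P] G t(1)
    by (simp add: max_face_scaleR face_of_imp_convex face_of_imp_subset)
  then have "H = F + dual_face G P" by (simp add: c F_def max_face_set_plus)
  ultimately show thesis using that Gp FG by blast
qed

lemma zero_mem_dual_polytope: "0 \<in> dual_polytope P"
  by (simp add: dual_polytope_def)

text \<open>This keeps the recursion going. The whole sum has center 0, being a superset of
  \<open>P\<close>; proper faces get theirs from \<open>chain_face_center\<close>.\<close>

lemma perfectly_centered_dual_sum:
  fixes P :: "'a::euclidean_space set"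
  assumes P: "perfectly_centered P"
  shows "perfectly_centered (P + dual_polytope P)"
proof -
  let ?Q = "P + dual_polytope P"
  have int: "0 \<in> interior P" using P by (rule perfectly_centered_zero_interior)
  have pol: "polytope P" "polytope (dual_polytope P)"
    using P perfectly_centered_imp_polytope int polytope_dual_polytope by auto
  have "P \<subseteq> ?Q" using set_zero_plus2[OF zero_mem_dual_polytope] by (simp add: add.commute)
  then have intQ: "0 \<in> interior ?Q" using int interior_mono by blast
  have "rel_interior H \<inter> outer_normal_cone H ?Q \<noteq> {}" if H: "H face_of ?Q" "H \<noteq> {}" for H
  proof (cases "H = ?Q")
    case True
    have "0 \<in> rel_interior ?Q" using intQ interior_subset_rel_interior by blast
    then show ?thesis using True by (auto simp: outer_normal_cone_iff max_face_zero)
  next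
    case False
    obtain F G where FG: "F \<in> proper_faces P" "G \<in> proper_faces P" "F \<subseteq> G"
      "H = F + dual_face G P"
      using face_of_dual_sum_chain[OF P H False] by metis
    obtain c where "c \<in> rel_interior H" "max_face P c = F"
      "max_face (dual_polytope P) c = dual_face G P"
      using chain_face_center[OF P FG(1-3)] FG(4) by metis
    then show ?thesis using FG(4) by (auto simp: outer_normal_cone_iff max_face_set_plus)
  qed
  moreover have "aff_dim ?Q = int DIM('a)"
    using intQ aff_dim_nonempty_interior by blast
  ultimately show ?thesis using pol by (simp add: perfectly_centered_def polytope_set_plus)
qed

text \<open>The bound on \<open>k\<close> excludes the whole sum, the one nonempty face that does
  not come from a pair.\<close>

lemma num_faces_dual_sum:
  fixes P :: "'a::euclidean_space set"
  assumes P: "perfectly_centered P" and "k < DIM('a)"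
  shows "num_faces k (P + dual_polytope P) =
    card {(F, G). F \<in> proper_faces P \<and> G \<in> proper_faces P \<and> F \<subseteq> G \<and>
      aff_dim F + int DIM('a) - 1 - aff_dim G = int k}"
    (is "_ = card ?C")
proof -
  let ?Q = "P + dual_polytope P"
  let ?f = "\<lambda>(F, G). F + dual_face G P"
  have "bij_betw ?f ?C {H. H face_of ?Q \<and> aff_dim H = int k}"
    unfolding bij_betw_def
  proof
    show "inj_on ?f ?C"
    proof (rule inj_onI, clarify)
      fix F G F' G' assume 1: "F \<in> proper_faces P" "G \<in> proper_faces P" "F \<subseteq> G"
        and 2: "F' \<in> proper_faces P" "G' \<in> proper_faces P" "F' \<subseteq> G'"
        and eq: "F + dual_face G P = F' + dual_face G' P"
      \<comment> \<open>The reconstruction equations have \<open>F\<close> and \<open>G\<close> on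
        both sides and would loop as rewrite rules, so they are chained explicitly.\<close>
      note trans = trans[OF _ trans[OF _ sym]]
      have "F = F'"
        by (rule trans[OF chain_face_fst[OF P 1] _ chain_face_fst[OF P 2]]) (simp only: eq)
      moreover have "G = G'"
        by (rule trans[OF chain_face_snd[OF P 1] _ chain_face_snd[OF P 2]]) (simp only: eq)
      ultimately show "F = F' \<and> G = G'" ..
    qed
  next
    show "?f ` ?C = {H. H face_of ?Q \<and> aff_dim H = int k}"
    proof
      show "?f ` ?C \<subseteq> {H. H face_of ?Q \<and> aff_dim H = int k}"
        using chain_face_props(1,2)[OF P] by auto
      show "{H. H face_of ?Q \<and> aff_dim H = int k} \<subseteq> ?f ` ?C"
      proof clarify
        fix H assume H: "H face_of ?Q" "aff_dim H = int k"
        have "H \<noteq> {}" using H(2) by auto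
        moreover have "H \<noteq> ?Q"
          using perfectly_centered_dual_sum[OF P] H(2) assms(2) by (auto simp: perfectly_centered_def)
        ultimately obtain F G where FG: "F \<in> proper_faces P" "G \<in> proper_faces P" "F \<subseteq> G"
          and HFG: "H = F + dual_face G P"
          using face_of_dual_sum_chain[OF P H(1)] by metis
        then have "(F, G) \<in> ?C" using chain_face_props(2)[OF P FG] H(2) by simp
        then show "H \<in> ?f ` ?C" using HFG by (force intro: image_eqI[of _ _ "(F, G)"])
      qed
    qed
  qed
  then show ?thesis unfolding num_faces_def by (rule bij_betw_same_card[symmetric])
qed

section \<open>Exactly two faces between faces whose dimensions differ by two\<close>

lemma face_of_subset_aff_dim_eq:
  assumes "convex S" "F face_of S" "G face_of S" "F \<subseteq> G" "aff_dim F = aff_dim G"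
  shows "F = G"
proof (rule ccontr)
  assume "F \<noteq> G"
  moreover have "F face_of G" using assms face_of_face by blast
  ultimately have "aff_dim F < aff_dim G"
    using assms(3) face_of_aff_dim_lt face_of_imp_convex by blast
  then show False using assms(5) by simp
qed

text \<open>A nonempty \<open>R\<close> is the intersection of the facets containing it, and a
  single facet has too large a dimension. If \<open>R\<close> is empty, \<open>S\<close> is a
  segment, and with only one extreme point it would collapse to that point.\<close>

lemma two_facets_exist:
  assumes S: "polytope S" and R: "R face_of S" "aff_dim R = aff_dim S - 2"
  obtains F G where "F facet_of S" "G facet_of S" "F \<noteq> G" "R \<subseteq> F" "R \<subseteq> G"
proof -
  have "R \<noteq> S" using R by auto
  have "\<exists>F G. F facet_of S \<and> G facet_of S \<and> F \<noteq> G \<and> R \<subseteq> F \<and> R \<subseteq> G"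
  proof (rule ccontr)
    assume *: "\<not> ?thesis"
    show False
    proof (cases "R = {}")
      case True
      then have dim: "aff_dim S = 1" using R by simp
      then obtain F where F: "F facet_of S" using polytope_facet_exists[OF S] by auto
      then have "aff_dim F = 0" using dim by (simp add: facet_of_def)
      then obtain a where a: "F = {a}" using aff_dim_eq_0 by blast
      have "v = a" if "v extreme_point_of S" for v
      proof -
        have "{v} facet_of S"
          using that dim by (simp add: facet_of_def face_of_singleton)
        then show ?thesis using * F a True by blast
      qed
      then have "{v. v extreme_point_of S} \<subseteq> {a}" by blast
      moreover have "S = convex hull {v. v extreme_point_of S}"
        using S by (intro Krein_Milman_Minkowski polytope_imp_compact polytope_imp_convex)
      ultimately have "S \<subseteq> {a}" by (metis convex_hull_singleton hull_mono)
      then have "aff_dim S \<le> 0" using aff_dim_subset[of S "{a}"] by simp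
      then show False using dim by simp
    next
      case False
      have P: "polyhedron S" using S by (rule polytope_imp_polyhedron)
      obtain F where F: "F facet_of S" "R \<subseteq> F"
        using face_of_polyhedron_subset_facet[OF P R(1) False \<open>R \<noteq> S\<close>] by blast
      then have "{G. G facet_of S \<and> R \<subseteq> G} = {F}" using * by blast
      then have "\<Inter> {G. G facet_of S \<and> R \<subseteq> G} = F" by simp
      with face_of_polyhedron[OF P R(1) False \<open>R \<noteq> S\<close>] have "R = F" by (rule trans)
      then show False using F(1) R(2) by (simp add: facet_of_def)
    qed
  qed
  then show thesis using that by blast
qed

text \<open>The slack functions of facets through a common ridge vanish on the ridge, so on the affine hull
  of \<open>S\<close> the third one is a combination of the other two. The coefficients are found by evaluating
  at points of the two facets off the ridge and are nonnegative, so \<open>F3\<close> lies in \<open>F1\<close> or in \<open>F2\<close>.\<close>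

lemma ridge_subset_facet_cases:
  fixes S :: "'a::euclidean_space set"
  assumes S: "polyhedron S" and R: "R face_of S" "aff_dim R = aff_dim S - 2"
    and F: "F1 facet_of S" "F2 facet_of S" "F1 \<noteq> F2" "R \<subseteq> F1" "R \<subseteq> F2"
    and F3: "F3 facet_of S" "R \<subseteq> F3"
  shows "F3 = F1 \<or> F3 = F2"
proof -
  have conv: "convex S" using S by (rule polyhedron_imp_convex)
  have faces: "F1 face_of S" "F2 face_of S" "F3 face_of S"
    and dims: "aff_dim F1 = aff_dim S - 1" "aff_dim F2 = aff_dim S - 1" "aff_dim F3 = aff_dim S - 1"
    using F F3 by (auto simp: facet_of_def)
  have RS: "R \<subseteq> S" using R(1) by (rule face_of_imp_subset)
  have hullInt: "x \<in> T" if "T face_of S" "x \<in> S" "x \<in> affine hull T" for T x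
    using face_of_imp_eq_affine_Int[OF conv that(1)] that by blast
  \<comment> \<open>The intersection is a proper face of \<open>F1\<close> containing
    \<open>R\<close>, and the dimensions leave no room between.\<close>
  have Int: "F1 \<inter> F2 = R"
  proof -
    have face: "F1 \<inter> F2 face_of S" using faces by (simp add: face_of_Int)
    have "F1 \<inter> F2 \<noteq> F1"
      using face_of_subset_aff_dim_eq[OF conv faces(1,2)] dims F(3) by auto
    moreover have "F1 \<inter> F2 face_of F1"
      using face faces face_of_face by blast
    ultimately have "aff_dim (F1 \<inter> F2) < aff_dim F1"
      using face_of_aff_dim_lt faces face_of_imp_convex by blast
    moreover have "aff_dim R \<le> aff_dim (F1 \<inter> F2)" using F by (simp add: aff_dim_subset)
    ultimately have "aff_dim R = aff_dim (F1 \<inter> F2)" using dims R by linarith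
    then show ?thesis using face_of_subset_aff_dim_eq[OF conv R(1) face] F by blast
  qed
  have "R \<noteq> F1" "R \<noteq> F2" using R(2) dims by auto
  then obtain x1 x2 where x: "x1 \<in> F1" "x1 \<notin> R" "x2 \<in> F2" "x2 \<notin> R" using F by blast
  then have xF: "x1 \<notin> F2" "x2 \<notin> F1" using Int by blast+
  have xS: "x1 \<in> S" "x2 \<in> S" using x faces face_of_imp_subset by blast+
  \<comment> \<open>The ridge and one further point from each facet affinely span \<open>S\<close>,
    so an affine identity need only be checked on \<open>B\<close>.\<close>
  define B where "B = insert x2 (insert x1 R)"
  have "x1 \<notin> affine hull R" using hullInt[OF R(1)] x xS by blast
  moreover have "x2 \<notin> affine hull (insert x1 R)"
  proof -
    have "affine hull (insert x1 R) \<subseteq> affine hull F1" using x F by (intro hull_mono) auto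
    then show ?thesis using hullInt[OF faces(1)] xF xS by blast
  qed
  ultimately have "aff_dim B = aff_dim S" using R(2) by (simp add: B_def aff_dim_insert)
  moreover have "B \<subseteq> S" using RS xS by (simp add: B_def)
  ultimately have hull: "affine hull B = affine hull S"
    by (intro affine_dim_equal) (auto simp: hull_mono B_def)
  obtain a1 b1 where 1: "S \<subseteq> {x. a1 \<bullet> x \<le> b1}" "F1 = S \<inter> {x. a1 \<bullet> x = b1}"
    using facet_of_polyhedron[OF S F(1)] by metis
  obtain a2 b2 where 2: "S \<subseteq> {x. a2 \<bullet> x \<le> b2}" "F2 = S \<inter> {x. a2 \<bullet> x = b2}"
    using facet_of_polyhedron[OF S F(2)] by metis
  obtain a3 b3 where 3: "S \<subseteq> {x. a3 \<bullet> x \<le> b3}" "F3 = S \<inter> {x. a3 \<bullet> x = b3}"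
    using facet_of_polyhedron[OF S F3(1)] by metis
  define s where "s = (b3 - a3 \<bullet> x2) / (b1 - a1 \<bullet> x2)"
  define t where "t = (b3 - a3 \<bullet> x1) / (b2 - a2 \<bullet> x1)"
  have pos: "b1 - a1 \<bullet> x2 > 0" "b2 - a2 \<bullet> x1 > 0"
    using xF xS 1 2 by (auto simp: order.strict_iff_order)
  then have st: "s \<ge> 0" "t \<ge> 0" using xS 3(1) by (auto simp: s_def t_def)
  let ?E = "{x. (a3 - s *\<^sub>R a1 - t *\<^sub>R a2) \<bullet> x = b3 - s * b1 - t * b2}"
  have E: "x \<in> ?E \<longleftrightarrow> b3 - a3 \<bullet> x = s * (b1 - a1 \<bullet> x) + t * (b2 - a2 \<bullet> x)" for x
    by (auto simp: inner_diff_left algebra_simps)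
  have "R \<subseteq> ?E" using F F3 1 2 3 unfolding E subset_iff by auto
  moreover have "x1 \<in> ?E" using x 1 pos unfolding E by (simp add: t_def)
  moreover have "x2 \<in> ?E" using x 2 pos unfolding E by (simp add: s_def)
  ultimately have "affine hull B \<subseteq> ?E"
    by (intro hull_minimal affine_hyperplane) (auto simp: B_def)
  then have comb: "b3 - a3 \<bullet> x = s * (b1 - a1 \<bullet> x) + t * (b2 - a2 \<bullet> x)" if "x \<in> S" for x
    using that E hull hull_inc by (metis (lifting) subsetD)
  have zero: "s * (b1 - a1 \<bullet> x) = 0 \<and> t * (b2 - a2 \<bullet> x) = 0" if "x \<in> F3" for x
  proof -
    have "x \<in> S" "b3 - a3 \<bullet> x = 0" using that 3 by auto
    moreover from this have "s * (b1 - a1 \<bullet> x) \<ge> 0" "t * (b2 - a2 \<bullet> x) \<ge> 0"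
      using 1 2 st by auto
    ultimately show ?thesis using comb[of x] by linarith
  qed
  \<comment> \<open>A nonzero coefficient forces the corresponding slack to vanish on
    \<open>F3\<close>. If both are zero, the third slack vanishes on all of \<open>S\<close>, which
    no facet allows.\<close>
  consider "s \<noteq> 0" | "t \<noteq> 0" | "s = 0" "t = 0" by blast
  then show ?thesis
  proof cases
    case 1
    then have "F3 \<subseteq> F1" using zero \<open>F1 = _\<close> 3(2) by auto
    then show ?thesis using face_of_subset_aff_dim_eq[OF conv faces(3,1)] dims by simp
  next
    case 2
    then have "F3 \<subseteq> F2" using zero \<open>F2 = _\<close> 3(2) by auto
    then show ?thesis using face_of_subset_aff_dim_eq[OF conv faces(3,2)] dims by simp
  next
    case 3
    then have "F3 = S" using comb \<open>F3 = _\<close> by auto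
    then show ?thesis using F3(1) by simp
  qed
qed

lemma card_facets_containing_ridge:
  fixes S :: "'a::euclidean_space set"
  assumes S: "polytope S" and R: "R face_of S" "aff_dim R = aff_dim S - 2"
  shows "card {F. F facet_of S \<and> R \<subseteq> F} = 2"
proof -
  obtain F G where FG: "F facet_of S" "G facet_of S" "F \<noteq> G" "R \<subseteq> F" "R \<subseteq> G"
    using two_facets_exist[OF S R] by metis
  then have "{F. F facet_of S \<and> R \<subseteq> F} = {F, G}"
    using ridge_subset_facet_cases[OF polytope_imp_polyhedron[OF S] R FG] by auto
  then show ?thesis using FG(3) by simp
qed

text \<open>These faces are the facets of \<open>G\<close> through its ridge \<open>R\<close>. The
  dimension of \<open>R\<close> is stated through \<open>k\<close> so that the empty face, of
  dimension -1, is covered with \<open>k = 0\<close>.\<close>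

lemma card_faces_between:
  fixes P :: "'a::euclidean_space set"
  assumes P: "polytope P" and R: "R face_of P" and G: "G face_of P" "R \<subseteq> G"
    and dim: "aff_dim G = aff_dim R + 2" "aff_dim R + 1 = int k"
  shows "card {E. E face_of P \<and> aff_dim E = int k \<and> R \<subseteq> E \<and> E \<subseteq> G} = 2"
proof -
  have "polytope G" using P G(1) face_of_polytope_polytope by blast
  moreover have "R face_of G" using R G face_of_face by blast
  ultimately have "card {E. E facet_of G \<and> R \<subseteq> E} = 2"
    using dim by (intro card_facets_containing_ridge) auto
  moreover have "{E. E face_of P \<and> aff_dim E = int k \<and> R \<subseteq> E \<and> E \<subseteq> G} = {E. E facet_of G \<and> R \<subseteq> E}"
    using dim face_of_face[OF G(1)] by (auto simp: facet_of_def)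
  ultimately show ?thesis by simp
qed

section \<open>Counting incidences and the faces of the sum in dimension three\<close>

definition faces_of_dim :: "nat \<Rightarrow> 'a::euclidean_space set \<Rightarrow> 'a set set" where
  "faces_of_dim k P = {F. F face_of P \<and> aff_dim F = int k}"

definition incident_faces :: "nat \<Rightarrow> nat \<Rightarrow> 'a::euclidean_space set \<Rightarrow> ('a set \<times> 'a set) set" where
  "incident_faces j k P = {(F, G). F \<in> faces_of_dim j P \<and> G \<in> faces_of_dim k P \<and> F \<subseteq> G}"

lemma num_faces_eq_card: "num_faces k P = card (faces_of_dim k P)"
  by (simp add: num_faces_def faces_of_dim_def)

lemma finite_faces_of_dim: "polytope P \<Longrightarrow> finite (faces_of_dim k P)"
  unfolding faces_of_dim_def by (rule finite_subset[OF _ finite_polytope_faces]) auto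

lemma finite_incident_faces: "polytope P \<Longrightarrow> finite (incident_faces j k P)"
  by (rule finite_subset[of _ "faces_of_dim j P \<times> faces_of_dim k P"])
     (auto simp: incident_faces_def finite_faces_of_dim)

text \<open>The two ends of an edge are the faces between the empty face and the edge.\<close>

lemma card_incident_vertices_edges:
  fixes P :: "'a::euclidean_space set"
  assumes P: "polytope P"
  shows "card (incident_faces 0 1 P) = 2 * num_faces 1 P"
proof -
  let ?A = "\<lambda>E. {F \<in> faces_of_dim 0 P. F \<subseteq> E}"
  have "card (?A E) = 2" if "E \<in> faces_of_dim 1 P" for E
    using that card_faces_between[OF P empty_face_of, of E 0]
    by (simp add: faces_of_dim_def conj_ac)
  then have "card (SIGMA E : faces_of_dim 1 P. ?A E) = 2 * card (faces_of_dim 1 P)"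
    using P by (simp add: finite_faces_of_dim)
  moreover have "incident_faces 0 1 P = prod.swap ` (SIGMA E : faces_of_dim 1 P. ?A E)"
    by (auto simp: incident_faces_def)
  ultimately show ?thesis
    by (simp add: card_image num_faces_eq_card)
qed

text \<open>The two facets at an edge are the faces between the edge and \<open>P\<close>
  itself.\<close>

lemma card_incident_edges_facets:
  fixes P :: "'a::euclidean_space set"
  assumes P: "polytope P" and dim: "aff_dim P = 3"
  shows "card (incident_faces 1 2 P) = 2 * num_faces 1 P"
proof -
  let ?A = "\<lambda>E. {F \<in> faces_of_dim 2 P. E \<subseteq> F}"
  have "P face_of P" using P by (simp add: face_of_refl polytope_imp_convex)
  then have "card (?A E) = 2" if "E \<in> faces_of_dim 1 P" for E
    using that card_faces_between[OF P, of E P 2] dim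
    by (auto simp: faces_of_dim_def face_of_imp_subset cong: conj_cong intro!: arg_cong[of _ _ card])
  then have "card (SIGMA E : faces_of_dim 1 P. ?A E) = 2 * card (faces_of_dim 1 P)"
    using P by (simp add: finite_faces_of_dim)
  moreover have "incident_faces 1 2 P = (SIGMA E : faces_of_dim 1 P. ?A E)"
    by (auto simp: incident_faces_def)
  ultimately show ?thesis by (simp add: num_faces_eq_card)
qed

text \<open>Both sides are half the number of flags: a flag is obtained from an incident vertex and facet
  by choosing one of the two edges between them, and from an incident edge and facet by choosing
  one of the two ends of the edge.\<close>

lemma card_incident_vertices_facets:
  fixes P :: "'a::euclidean_space set"
  assumes P: "polytope P"
  shows "card (incident_faces 0 2 P) = card (incident_faces 1 2 P)"
proof -
  \<comment> \<open>Related pairs are exactly those that together form a flag; each side has two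
    partners, so \<open>sum_multicount\<close> gives equality.\<close>
  let ?R = "\<lambda>(V, F) (E, F'). F = F' \<and> V \<subseteq> E"
  have "card {y \<in> incident_faces 1 2 P. ?R x y} = 2" if "x \<in> incident_faces 0 2 P" for x
  proof -
    obtain V F where x: "x = (V, F)" by (cases x)
    let ?B = "{E. E face_of P \<and> aff_dim E = int 1 \<and> V \<subseteq> E \<and> E \<subseteq> F}"
    have "{y \<in> incident_faces 1 2 P. ?R x y} = (\<lambda>E. (E, F)) ` ?B"
      using that by (auto simp: x incident_faces_def faces_of_dim_def)
    moreover have "card ?B = 2"
      using that by (intro card_faces_between[OF P]) (auto simp: x incident_faces_def faces_of_dim_def)
    ultimately show ?thesis by (simp add: card_image inj_on_def)
  qed
  moreover have "card {x \<in> incident_faces 0 2 P. ?R x y} = 2" if "y \<in> incident_faces 1 2 P" for y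
  proof -
    obtain E F where y: "y = (E, F)" by (cases y)
    let ?B = "{V. V face_of P \<and> aff_dim V = int 0 \<and> {} \<subseteq> V \<and> V \<subseteq> E}"
    have "{x \<in> incident_faces 0 2 P. ?R x y} = (\<lambda>V. (V, F)) ` ?B"
      using that by (auto simp: y incident_faces_def faces_of_dim_def)
    moreover have "card ?B = 2"
      using that by (intro card_faces_between[OF P]) (auto simp: y incident_faces_def faces_of_dim_def)
    ultimately show ?thesis by (simp add: card_image inj_on_def)
  qed
  ultimately show ?thesis
    using sum_multicount[of "incident_faces 0 2 P" "incident_faces 1 2 P" ?R 2]
      finite_incident_faces[OF P] by simp
qed

lemma proper_faces_iff_dim:
  fixes P :: "'a::euclidean_space set"
  assumes "convex P" "aff_dim P = 3"
  shows "F \<in> proper_faces P \<longleftrightarrow> F \<in> faces_of_dim 0 P \<or> F \<in> faces_of_dim 1 P \<or> F \<in> faces_of_dim 2 P"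
proof
  assume "F \<in> proper_faces P"
  then have F: "F face_of P" "F \<noteq> {}" "F \<noteq> P" by (auto simp: proper_faces_def)
  have "aff_dim F < 3" using face_of_aff_dim_lt[OF assms(1) F(1,3)] assms(2) by simp
  moreover have "aff_dim F \<ge> 0" using F(2) by (metis aff_dim_negative_iff not_less)
  ultimately show "F \<in> faces_of_dim 0 P \<or> F \<in> faces_of_dim 1 P \<or> F \<in> faces_of_dim 2 P"
    using F(1) by (auto simp: faces_of_dim_def)
qed (use assms in \<open>auto simp: faces_of_dim_def proper_faces_def\<close>)

lemma num_faces_dual_sum_3:
  fixes P :: "(real ^ 3) set"
  assumes P: "perfectly_centered P"
  shows num_vertices_dual_sum: "num_faces 0 (P + dual_polytope P) = 2 * num_faces 1 P"
    and num_edges_dual_sum: "num_faces 1 (P + dual_polytope P) = 4 * num_faces 1 P"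
    and num_facets_dual_sum:
      "num_faces 2 (P + dual_polytope P) = num_faces 0 P + num_faces 1 P + num_faces 2 P"
proof -
  have pol: "polytope P" and dim: "aff_dim P = 3"
    using P by (auto simp: perfectly_centered_def)
  note conv = polytope_imp_convex[OF pol]
  note proper = proper_faces_iff_dim[OF conv dim]
  note fin = finite_faces_of_dim[OF pol] finite_incident_faces[OF pol]
  define C where "C k = {(F, G). F \<in> proper_faces P \<and> G \<in> proper_faces P \<and> F \<subseteq> G \<and>
      aff_dim F + int DIM(real ^ 3) - 1 - aff_dim G = int k}" for k
  have C: "num_faces k (P + dual_polytope P) = card (C k)" if "k < 3" for k
    unfolding C_def using that by (intro num_faces_dual_sum[OF P]) simp
  \<comment> \<open>The sum has dimension \<open>aff_dim F + 2 - aff_dim G\<close>. Value 0 needs a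
    vertex in a facet, value 1 a vertex in an edge or an edge in a facet, and value 2 forces
    \<open>F = G\<close>.\<close>
  have "C 0 = incident_faces 0 2 P"
    by (auto simp: C_def proper incident_faces_def) (auto simp: faces_of_dim_def)
  then show "num_faces 0 (P + dual_polytope P) = 2 * num_faces 1 P"
    using C[of 0] card_incident_vertices_facets[OF pol] card_incident_edges_facets[OF pol dim] by simp
  have "C 1 = incident_faces 0 1 P \<union> incident_faces 1 2 P"
    by (auto simp: C_def proper incident_faces_def) (auto simp: faces_of_dim_def)
  moreover have "incident_faces 0 1 P \<inter> incident_faces 1 2 P = {}"
    by (auto simp: incident_faces_def faces_of_dim_def)
  ultimately show "num_faces 1 (P + dual_polytope P) = 4 * num_faces 1 P"
    using C[of 1] card_incident_vertices_edges[OF pol] card_incident_edges_facets[OF pol dim] fin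
    by (simp add: card_Un_disjoint)
  let ?U = "faces_of_dim 0 P \<union> faces_of_dim 1 P \<union> faces_of_dim 2 P"
  have "F = G" if "(F, G) \<in> C 2" for F G
    using that by (intro face_of_subset_aff_dim_eq[OF conv]) (auto simp: C_def proper_faces_def)
  moreover have "(F, F) \<in> C 2 \<longleftrightarrow> F \<in> ?U" for F
    by (auto simp: C_def proper)
  moreover have "F \<in> ?U" if "(F, G) \<in> C 2" for F G
    using that by (auto simp: C_def proper)
  ultimately have "C 2 = (\<lambda>F. (F, F)) ` ?U" by fast
  then have "card (C 2) = card ?U" by (simp add: card_image inj_on_def)
  also have "\<dots> = num_faces 0 P + num_faces 1 P + num_faces 2 P"
  proof -
    have "faces_of_dim i P \<inter> faces_of_dim j P = {}" if "i \<noteq> j" for i j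
      using that by (auto simp: faces_of_dim_def)
    then show ?thesis
      using fin by (simp add: card_Un_disjoint Int_Un_distrib2 num_faces_eq_card)
  qed
  finally show "num_faces 2 (P + dual_polytope P) = num_faces 0 P + num_faces 1 P + num_faces 2 P"
    using C[of 2] by simp
qed

section \<open>Solving the recursion\<close>

lemma perfectly_centered_dual_sum_iterate:
  "perfectly_centered P \<Longrightarrow> perfectly_centered (dual_sum_iterate P i)"
  by (induction i) (simp_all add: perfectly_centered_dual_sum)

theorem theorem8:
  fixes P :: "(real ^ 3) set" and n :: nat
  assumes "perfectly_centered P" and "n \<ge> 1"
  shows "num_faces 0 (dual_sum_iterate P n) = 4 ^ (n - 1) * num_faces 0 (dual_sum_iterate P 1) \<and>
         num_faces 1 (dual_sum_iterate P n) = 2 * 4 ^ (n - 1) * num_faces 0 (dual_sum_iterate P 1) \<and>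
         num_faces 2 (dual_sum_iterate P n) =
           num_faces 2 (dual_sum_iterate P 1) + (4 ^ (n - 1) - 1) * num_faces 0 (dual_sum_iterate P 1)"
proof -
  define f where "f k i = num_faces k (dual_sum_iterate P i)" for k i
  have step: "f 0 (Suc i) = 2 * f 1 i" "f 1 (Suc i) = 4 * f 1 i"
    "f 2 (Suc i) = f 0 i + f 1 i + f 2 i" for i
    using num_faces_dual_sum_3[OF perfectly_centered_dual_sum_iterate[OF assms(1)], of i]
    by (simp_all add: f_def)
  have "f 0 (Suc m) = 4 ^ m * f 0 1 \<and> f 1 (Suc m) = 2 * 4 ^ m * f 0 1 \<and>
      f 2 (Suc m) = f 2 1 + (4 ^ m - 1) * f 0 1" for m
  proof (induction m)
    \<comment> \<open>The edge count holds since \<open>f 1 1\<close> and \<open>2 * f 0 1\<close>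
      both equal \<open>4 * f 1 0\<close>.\<close>
    case 0
    then show ?case using step[of 0] by simp
  next
    case (Suc m)
    \<comment> \<open>Naming the difference removes the truncated subtraction before the
      algebra.\<close>
    define a :: nat where "a = 4 ^ m - 1"
    have "4 ^ m = Suc a" by (simp add: a_def)
    then show ?case using Suc step[of "Suc m"] by (simp add: algebra_simps)
  qed
  from this[of "n - 1"] show ?thesis using assms(2) by (simp add: f_def)
qed

end
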